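(* Let $r$ be a power of the prime $p$, and let $m$ be an integer with $2<m<r-1$ and $p\nmid(m-1)$. Let $h$ be a positive integer. There exists a Desarguesian net of order $r$ and degree $m$, with a line $L$ and a point $x$ not on $L$, such that the maximal clique $C_{x,L}$ has size $m-1+h$, if and only if $h\mid\gcd(r-1,m-2)$.
   Context: A Desarguesian net of order $r$ and degree $m$: point set $\mathbb{F}_{r^2}$; fix $S\subseteq\mathbb{F}_{r^2}^*$, a union of $m$ cosets of $\mathbb{F}_r^*$ in $\mathbb{F}_{r^2}^*$; lines are the sets $a+d\,\mathbb{F}_r$ with $a\in\mathbb{F}_{r^2}$, $d\in S$; the collinearity graph has vertex set $\mathbb{F}_{r^2}$, distinct vertices adjacent iff their difference lies in $S$. For a vertex $y$, $y^\perp$ is $\{y\}$ together with its neighbours. For a line $L$ and a point $x\notin L$, $C_{x,L}$ denotes the unique maximal clique of the collinearity graph containing $\{x\}\cup(x^\perp\cap L)$ (existence and uniqueness are known). *)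

theory Defs
  imports "HOL-Library.Cardinality" "HOL-Library.Ramsey" "HOL-Algebra.Algebraic_Closure_Type"
begin

text \<open>
  The point set of a net of order \<open>r\<close> is a whole type \<open>'a\<close> that is a field with \<open>r\<^sup>2\<close> elements;
  \<open>K\<close> is its subfield with \<open>r\<close> elements, and \<open>S\<close> is the set of directions.
\<close>

definition unit_cosets :: "'a::field set \<Rightarrow> 'a set set" where
  "unit_cosets K = {(*) d ` (K - {0}) | d. d \<noteq> 0}"

definition desarguesian_net :: "nat \<Rightarrow> nat \<Rightarrow> 'a::{field,finite} set \<Rightarrow> 'a set \<Rightarrow> bool" where
  "desarguesian_net r m K S \<longleftrightarrow>
     CARD('a) = r ^ 2 \<and>
     subfield K (ring_of_type_algebra :: 'a ring) \<and> card K = r \<and>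
     (\<exists>\<C> \<subseteq> unit_cosets K. card \<C> = m \<and> S = \<Union>\<C>)"

definition net_lines :: "'a::field set \<Rightarrow> 'a set \<Rightarrow> 'a set set" where
  "net_lines K S = {(\<lambda>k. a + d * k) ` K | a d. d \<in> S}"

text \<open>
  The edge set of the collinearity graph on \<open>UNIV\<close>. In a net \<open>S = - S\<close>, because \<open>- 1 \<in> K\<close>, so
  the order in which the two ends are subtracted does not matter.
\<close>

definition collinearity_edges :: "'a::field set \<Rightarrow> 'a set set" where
  "collinearity_edges S = {{y, z} | y z. y \<noteq> z \<and> y - z \<in> S}"

definition perp :: "'a::field set \<Rightarrow> 'a \<Rightarrow> 'a set" where
  "perp S y = insert y {z. {y, z} \<in> collinearity_edges S}"

definition maximal_clique :: "'a set set \<Rightarrow> 'a set \<Rightarrow> bool" where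
  "maximal_clique E C \<longleftrightarrow> clique C E \<and> (\<forall>D. clique D E \<and> C \<subseteq> D \<longrightarrow> D = C)"

definition net_clique :: "'a::field set \<Rightarrow> 'a \<Rightarrow> 'a set \<Rightarrow> 'a set" where
  "net_clique S x L =
     (THE C. maximal_clique (collinearity_edges S) C \<and> {x} \<union> (perp S x \<inter> L) \<subseteq> C)"

end

theory Submission
  imports Defs
begin

text \<open>
  Normalise \<open>L\<close> to \<open>K\<close>, let \<open>T\<close> be the set of the \<open>m - 1\<close> points of \<open>K\<close> collinear with \<open>x\<close>, and
  translate so that the elements of \<open>T\<close> sum to \<open>0\<close>; this is possible because \<open>p\<close> does not divide
  \<open>m - 1\<close>. A point \<open>\<alpha> * x + \<beta>\<close> with \<open>\<alpha> \<noteq> 0\<close> is collinear with all of \<open>T\<close> iff the affine map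
  \<open>t \<mapsto> (t - \<beta>) / \<alpha>\<close> preserves \<open>T\<close>. Such a map fixes the barycentre \<open>0\<close>, so \<open>\<beta> = 0\<close>, and
  \<open>\<alpha> * x\<close> is collinear with \<open>x\<close> iff \<open>\<alpha> = 1\<close> or \<open>0 \<in> T\<close>. Hence the clique consists of \<open>T\<close> and
  of \<open>h\<close> further points, where \<open>h\<close> is the order of the group of dilations of \<open>T\<close> if \<open>0 \<in> T\<close>, and
  \<open>1\<close> otherwise. This group acts semiregularly on \<open>K - {0}\<close> and on \<open>T - {0}\<close>, so its order divides
  \<open>r - 1\<close> and \<open>m - 2\<close>. Conversely, any \<open>T\<close> in \<open>K\<close> with sum \<open>0\<close> arises in this way, so for
  each \<open>h\<close> it suffices to construct a suitable \<open>T\<close>.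
\<close>

section \<open>Subfields and multiplicative subgroups\<close>

text \<open>Replaces the record-based notion by closure under the type class operations. As
  \<open>x / 0 = 0\<close> and \<open>0 = 1 - 1\<close> lies in \<open>K\<close>, quotients may
  range over all of \<open>K\<close>.\<close>

lemma subfield_ring_of_type_algebra_iff:
  fixes K :: "'a::field set"
  shows "subfield K (ring_of_type_algebra :: 'a ring) \<longleftrightarrow>
    1 \<in> K \<and> (\<forall>x\<in>K. \<forall>y\<in>K. x - y \<in> K \<and> x / y \<in> K)"
    (is "subfield K ?R \<longleftrightarrow> ?C")
proof
  interpret R: field ?R by (rule field_from_type_algebra)
  have R [simp]: "carrier ?R = UNIV" "\<one>\<^bsub>?R\<^esub> = 1" "\<zero>\<^bsub>?R\<^esub> = 0"
    "\<And>x y. x \<otimes>\<^bsub>?R\<^esub> y = x * y" "\<And>x y. x \<oplus>\<^bsub>?R\<^esub> y = x + y"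
    by (simp_all add: ring_of_type_algebra_def)
  have neg [simp]: "\<ominus>\<^bsub>?R\<^esub> x = - x" for x
    using R.minus_equality[of "- x" x] by simp
  have inv: "inv\<^bsub>?R\<^esub> x = inverse x" if "x \<noteq> 0" for x
    using R.comm_inv_char[of x "inverse x"] that by simp
  show ?C if K: "subfield K ?R"
  proof (intro conjI ballI)
    note sub = subringE[OF subfieldE(1)[OF K], simplified]
    show "1 \<in> K" by (rule sub)
    fix x y assume xy: "x \<in> K" "y \<in> K"
    show "x - y \<in> K" using sub(7)[OF xy(1) sub(5)[OF xy(2)]] by simp
    show "x / y \<in> K"
    proof (cases "y = 0")
      case False
      then have "inverse y \<in> K"
        using R.subfield_m_inv(1)[OF K, of y] xy(2) inv by simp
      then show ?thesis using sub(6)[OF xy(1)] by (simp add: divide_inverse)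
    qed (use sub in simp)
  qed
  show "subfield K ?R" if C: ?C
  proof (rule R.subfieldI')
    have K: "1 \<in> K" "\<And>x y. x \<in> K \<Longrightarrow> y \<in> K \<Longrightarrow> x - y \<in> K"
      "\<And>x y. x \<in> K \<Longrightarrow> y \<in> K \<Longrightarrow> x / y \<in> K"
      using C by auto
    have "0 \<in> K" using K(2)[OF K(1) K(1)] by simp
    then have neg': "- x \<in> K" if "x \<in> K" for x using K(2)[of 0 x] that by simp
    have "x * y \<in> K" if "x \<in> K" "y \<in> K" for x y
      using K(3)[OF that(1) K(3)[OF K(1) that(2)]] by simp
    moreover have "x + y \<in> K" if "x \<in> K" "y \<in> K" for x y
      using K(2)[OF that(1) neg'[OF that(2)]] by simp
    ultimately show "subring K ?R"
      using K(1) neg' by (intro R.subringI) auto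
    show "inv\<^bsub>?R\<^esub> k \<in> K" if "k \<in> K - {\<zero>\<^bsub>?R\<^esub>}" for k
      using that K(3)[OF K(1), of k] inv[of k] by (simp add: divide_inverse)
  qed
qed

text \<open>The one-step subgroup criterion. Since \<open>x / 0 = 0\<close>, a whole subfield passes
  the quotient test, so \<open>0\<close> is excluded explicitly.\<close>

definition mult_subgroup :: "'a::field set \<Rightarrow> bool" where
  "mult_subgroup U \<longleftrightarrow> 1 \<in> U \<and> 0 \<notin> U \<and> (\<forall>u\<in>U. \<forall>v\<in>U. u / v \<in> U)"

lemma mult_subgroupD:
  assumes "mult_subgroup U"
  shows "1 \<in> U" "0 \<notin> U" "u \<in> U \<Longrightarrow> v \<in> U \<Longrightarrow> u / v \<in> U"
    "u \<in> U \<Longrightarrow> inverse u \<in> U" "u \<in> U \<Longrightarrow> v \<in> U \<Longrightarrow> u * v \<in> U"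
proof -
  show 1: "1 \<in> U" "0 \<notin> U"
    using assms by (auto simp: mult_subgroup_def)
  show 2: "u / v \<in> U" if "u \<in> U" "v \<in> U" for u v
    using assms that by (auto simp: mult_subgroup_def)
  show 3: "inverse u \<in> U" if "u \<in> U" for u using 2[OF 1(1) that] by (simp add: divide_inverse)
  show "u * v \<in> U" if "u \<in> U" "v \<in> U" for u v
    using 2[OF that(1) 3[OF that(2)]] by (simp add: divide_inverse)
qed

lemma coset_eq:
  assumes U: "mult_subgroup U" and y: "y \<in> (*) d ` U"
  shows "(*) d ` U = (*) y ` U"
proof -
  obtain u where u: "u \<in> U" "y = d * u" using y by auto
  note U = mult_subgroupD[OF U]
  have "u \<noteq> 0" using u U by auto
  show ?thesis
  proof (intro equalityI image_subsetI)
    fix v assume v: "v \<in> U"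
    have "d * v = y * (v / u)" using u \<open>u \<noteq> 0\<close> by simp
    then show "d * v \<in> (*) y ` U" using U(3)[OF v u(1)] by blast
    have "y * v = d * (u * v)" using u by simp
    then show "y * v \<in> (*) d ` U" using U(5)[OF u(1) v] by blast
  qed
qed

lemma card_Union_cosets:
  fixes U :: "'a::{field,finite} set"
  assumes U: "mult_subgroup U" and C: "\<C> \<subseteq> {(*) d ` U | d. d \<noteq> 0}"
  shows "card (\<Union>\<C>) = card \<C> * card U"
proof -
  have "card U * card \<C> = card (\<Union>\<C>)"
  proof (rule card_partition)
    fix c assume "c \<in> \<C>"
    then obtain d where "d \<noteq> 0" "c = (*) d ` U" using C by blast
    then show "card c = card U" by (simp add: card_image inj_on_def)
  next
    fix c c' assume c: "c \<in> \<C>" "c' \<in> \<C>" "c \<noteq> c'"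
    then obtain d d' where d: "c = (*) d ` U" "c' = (*) d' ` U" using C by blast
    show "c \<inter> c' = {}"
    proof (rule ccontr)
      assume "c \<inter> c' \<noteq> {}"
      then obtain y where "y \<in> c" "y \<in> c'" by blast
      then show False using coset_eq[OF U] c(3) d by metis
    qed
  qed auto
  then show ?thesis by (simp add: mult.commute)
qed

lemma Union_own_cosets:
  assumes U: "mult_subgroup U" and A: "\<And>a u. a \<in> A \<Longrightarrow> u \<in> U \<Longrightarrow> a * u \<in> A"
  shows "\<Union>((\<lambda>a. (*) a ` U) ` A) = A"
proof -
  have "a \<in> (*) a ` U" for a using mult_subgroupD(1)[OF U] by (auto intro: image_eqI[of _ _ 1])
  then show ?thesis using A by blast
qed

text \<open>Lagrange's argument for a free action: off \<open>0\<close>, multiplication by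
  \<open>U\<close> splits \<open>A\<close> into cosets of size \<open>card U\<close>. With the
  dilations as \<open>U\<close> it yields both divisibilities of \<open>h\<close>.\<close>

lemma card_mult_subgroup_dvd:
  fixes U :: "'a::{field,finite} set"
  assumes U: "mult_subgroup U" and A: "\<And>a u. a \<in> A \<Longrightarrow> u \<in> U \<Longrightarrow> a * u \<in> A" and "0 \<notin> A"
  shows "card U dvd card A"
proof -
  have "(\<lambda>a. (*) a ` U) ` A \<subseteq> {(*) d ` U | d. d \<noteq> 0}" using \<open>0 \<notin> A\<close> by blast
  from card_Union_cosets[OF U this] show ?thesis
    using Union_own_cosets[OF U A] by (metis dvd_triv_right)
qed

section \<open>Powers of a generator, cyclicity and characteristic of a finite field\<close>

lemma power_eq_power_iff_mod:
  fixes g :: "'a::field"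
  assumes "g \<noteq> 0" and order: "\<And>n. g ^ n = 1 \<longleftrightarrow> N dvd n"
  shows "g ^ a = g ^ b \<longleftrightarrow> a mod N = b mod N"
proof -
  have *: "g ^ a = g ^ b \<longleftrightarrow> a mod N = b mod N" if "a \<le> b" for a b
  proof -
    have "g ^ b = g ^ a * g ^ (b - a)" using that by (simp flip: power_add)
    then have "g ^ a = g ^ b \<longleftrightarrow> g ^ (b - a) = 1" using \<open>g \<noteq> 0\<close> by simp
    also have "\<dots> \<longleftrightarrow> b mod N = a mod N" using that order by (simp add: mod_eq_dvd_iff_nat)
    finally show ?thesis by auto
  qed
  show ?thesis using *[of a b] *[of b a] by (cases "a \<le> b") auto
qed

lemma range_power_eq:
  fixes g :: "'a::field"
  assumes "g \<noteq> 0" and order: "\<And>n. g ^ n = 1 \<longleftrightarrow> N dvd n" and "N > 0"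
  shows "range ((^) g) = (^) g ` {..<N}" and "inj_on ((^) g) {..<N}"
proof -
  note eq = power_eq_power_iff_mod[OF assms(1,2)]
  have "g ^ n = g ^ (n mod N)" "n mod N < N" for n using \<open>N > 0\<close> eq by simp_all
  then show "range ((^) g) = (^) g ` {..<N}" by blast
  show "inj_on ((^) g) {..<N}" by (auto simp: inj_on_def eq)
qed

lemma finite_field_generator:
  obtains g :: "'a::{field,finite}"
  where "g \<noteq> 0" "UNIV - {0} = range ((^) g)" "\<And>n. g ^ n = 1 \<longleftrightarrow> CARD('a) - 1 dvd n"
proof -
  let ?R = "ring_of_type_algebra :: 'a ring"
  interpret R: field ?R by (rule field_from_type_algebra)
  have R [simp]: "carrier ?R = UNIV" "\<one>\<^bsub>?R\<^esub> = 1" "\<zero>\<^bsub>?R\<^esub> = 0" "\<And>x y. x \<otimes>\<^bsub>?R\<^esub> y = x * y"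
    by (simp_all add: ring_of_type_algebra_def)
  have pow [simp]: "x [^]\<^bsub>?R\<^esub> n = x ^ n" for x and n :: nat
    by (induction n) (simp_all add: mult.commute)
  obtain g :: 'a where g: "g \<noteq> 0" "UNIV - {0} = range ((^) g)"
  proof -
    obtain g where "g \<in> carrier (mult_of ?R)"
      "carrier (mult_of ?R) = {g [^]\<^bsub>?R\<^esub> i | i::nat. i \<in> UNIV}"
      using R.finite_field_mult_group_has_gen by auto
    then have "g \<noteq> 0" "UNIV - {0} = {g ^ i | i::nat. i \<in> UNIV}" by simp_all
    moreover have "{g ^ i | i::nat. i \<in> UNIV} = range ((^) g)" by blast
    ultimately show ?thesis by (intro that[of g]) simp_all
  qed
  have "\<not> inj ((^) g)" using finite_imageD[of "(^) g" UNIV] by auto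
  then obtain i j where ij: "i < j" "g ^ i = g ^ j" unfolding inj_def by (metis linorder_neqE_nat)
  have "g ^ j = g ^ i * g ^ (j - i)" using ij(1) by (simp flip: power_add)
  then have "g ^ (j - i) = 1" using g(1) ij(2) by simp
  then have ex: "\<exists>d. d > 0 \<and> g ^ d = 1" using ij(1) by (intro exI[of _ "j - i"]) simp
  \<comment> \<open>The order of \<open>g\<close>; counting the distinct powers of \<open>g\<close>
    identifies it with \<open>CARD('a) - 1\<close>.\<close>
  define d where "d = (LEAST d. d > 0 \<and> g ^ d = 1)"
  have d: "d > 0" "g ^ d = 1" using LeastI_ex[OF ex] by (auto simp: d_def)
  have minimal: "\<not> (e > 0 \<and> g ^ e = 1)" if "e < d" for e
    using not_less_Least that unfolding d_def by blast
  have order: "g ^ n = 1 \<longleftrightarrow> d dvd n" for n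
  proof
    assume "g ^ n = 1"
    moreover have "g ^ n = (g ^ d) ^ (n div d) * g ^ (n mod d)" by (simp flip: power_mult power_add)
    ultimately have "g ^ (n mod d) = 1" using d by simp
    moreover have "n mod d < d" using d by simp
    ultimately have "n mod d = 0" using minimal by auto
    then show "d dvd n" by auto
  qed (use d in \<open>auto simp: power_mult\<close>)
  have "card (UNIV - {0::'a}) = d"
    using range_power_eq[OF g(1) order d(1)] g(2) by (simp add: card_image)
  then have "d = CARD('a) - 1" by simp
  then show ?thesis using that g order by blast
qed

text \<open>Translation by \<open>1\<close> permutes the field; comparing the sums before and after
  gives \<open>p ^ n = 0\<close> in the field, hence \<open>p = 0\<close> there.\<close>

lemma CHAR_eq_prime:
  assumes p: "Factorial_Ring.prime p" and card: "CARD('a::{field,finite}) = p ^ n"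
  shows "CHAR('a) = p"
proof -
  have "(\<Sum>x\<in>UNIV. x) = (\<Sum>x\<in>UNIV. x + 1 :: 'a)"
    by (rule sum.reindex_bij_witness[of _ "\<lambda>x. x + 1" "\<lambda>x. x - 1"]) auto
  then have "of_nat CARD('a) = (0::'a)" by (simp add: sum.distrib)
  then have "of_nat p = (0::'a)" unfolding card by simp
  then have "CHAR('a) dvd p" by (simp add: of_nat_eq_0_iff_char_dvd)
  then show ?thesis using p by (auto simp: prime_nat_iff)
qed

section \<open>Cliques of a net\<close>

text \<open>The stabiliser of \<open>T\<close> in the multiplicative group of \<open>K\<close>.
  Inclusion suffices in the finite case, because an injective self-map of \<open>T\<close> is
  onto.\<close>

definition dilations :: "'a::field set \<Rightarrow> 'a set \<Rightarrow> 'a set" where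
  "dilations K T = {u \<in> K - {0}. \<forall>t\<in>T. t * u \<in> T}"

text \<open>Expresses that \<open>S\<close> is a union of cosets of \<open>K - {0}\<close> without
  naming them; their number is recovered from \<open>card S\<close>.\<close>

definition directions :: "'a::field set \<Rightarrow> 'a set \<Rightarrow> bool" where
  "directions K S \<longleftrightarrow> 0 \<notin> S \<and> (\<forall>s\<in>S. \<forall>k\<in>K - {0}. s * k \<in> S)"

lemma collinearity_edges_iff:
  assumes "\<And>s. s \<in> S \<Longrightarrow> - s \<in> S"
  shows "{y, z} \<in> collinearity_edges S \<longleftrightarrow> y \<noteq> z \<and> y - z \<in> S"
  using assms[of "y - z"] assms[of "z - y"] unfolding collinearity_edges_def
  by (auto simp: doubleton_eq_iff)

text \<open>Any clique containing the prescribed points consists of points equal or adjacent to each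
  of them, so it lies in \<open>M\<close>. Thus \<open>M\<close> is the largest such clique and the
  only maximal one.\<close>

lemma net_clique_eqI:
  assumes sym: "\<And>s. s \<in> S \<Longrightarrow> - s \<in> S"
    and clique: "\<And>y z. y \<in> M \<Longrightarrow> z \<in> M \<Longrightarrow> y \<noteq> z \<Longrightarrow> y - z \<in> S"
    and sub: "{x} \<union> (perp S x \<inter> L) \<subseteq> M"
    and max: "\<And>y. (\<And>z. z \<in> {x} \<union> (perp S x \<inter> L) \<Longrightarrow> y \<noteq> z \<Longrightarrow> y - z \<in> S) \<Longrightarrow> y \<in> M"
  shows "net_clique S x L = M"
proof -
  let ?E = "collinearity_edges S"
  note E = collinearity_edges_iff[of S, OF sym]
  have sub_M: "C \<subseteq> M" if "clique C ?E" "{x} \<union> (perp S x \<inter> L) \<subseteq> C" for C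
  proof
    fix y assume y: "y \<in> C"
    show "y \<in> M"
    proof (rule max)
      fix z assume "z \<in> {x} \<union> (perp S x \<inter> L)" "y \<noteq> z"
      then show "y - z \<in> S" using that y E unfolding clique_def by blast
    qed
  qed
  have M: "clique M ?E" using clique E by (simp add: clique_def)
  show ?thesis unfolding net_clique_def
  proof (rule the_equality)
    show "maximal_clique ?E M \<and> {x} \<union> (perp S x \<inter> L) \<subseteq> M"
      using M sub sub_M unfolding maximal_clique_def by blast
    fix C assume "maximal_clique ?E C \<and> {x} \<union> (perp S x \<inter> L) \<subseteq> C"
    then show "C = M" using M sub_M unfolding maximal_clique_def by blast
  qed
qed

section \<open>Coordinates and directions in a quadratic extension\<close>

locale quadratic_extension =
  fixes K :: "'a::{field,finite} set"
  assumes one: "1 \<in> K"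
    and diff: "\<And>x y. x \<in> K \<Longrightarrow> y \<in> K \<Longrightarrow> x - y \<in> K"
    and divide: "\<And>x y. x \<in> K \<Longrightarrow> y \<in> K \<Longrightarrow> x / y \<in> K"
    and card_UNIV: "CARD('a) = card K ^ 2"
begin

lemma zero: "0 \<in> K" using diff[OF one one] by simp
lemma neg: "x \<in> K \<Longrightarrow> - x \<in> K" using diff[OF zero] by simp
lemma add: "x \<in> K \<Longrightarrow> y \<in> K \<Longrightarrow> x + y \<in> K" using diff[OF _ neg] by fastforce
lemma mult: "x \<in> K \<Longrightarrow> y \<in> K \<Longrightarrow> x * y \<in> K" using divide[OF _ divide[OF one]] by fastforce
lemma sum: "(\<And>i. i \<in> I \<Longrightarrow> f i \<in> K) \<Longrightarrow> sum f I \<in> K"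
  by (induction I rule: infinite_finite_induct) (auto intro: zero add)
lemma of_nat: "of_nat n \<in> K" by (induction n) (auto intro: zero one add)
lemmas closed = zero one neg add diff mult divide

lemma card_K: "card (K - {0}) = card K - 1" using zero by simp

lemma card_K_gt_1: "1 < card K"
  using card_mono[of K "{0, 1}"] zero one by simp

lemma mult_subgroup_K: "mult_subgroup (K - {0})"
  using one divide by (auto simp: mult_subgroup_def)

lemma mult_subgroup_dilations: "mult_subgroup (dilations K T)"
proof -
  have "t / v \<in> T" if "v \<in> dilations K T" "t \<in> T" for t v
  proof -
    have *: "(\<lambda>t. t * v) ` T = T"
      using that(1) by (intro endo_inj_surj) (auto simp: dilations_def inj_on_def)
    then obtain t' where "t' \<in> T" "t = t' * v" using \<open>t \<in> T\<close> * by blast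
    moreover have "v \<noteq> 0" using that(1) by (simp add: dilations_def)
    ultimately show ?thesis by simp
  qed
  then have "u / v \<in> dilations K T" if "u \<in> dilations K T" "v \<in> dilations K T" for u v
    using that divide by (fastforce simp: dilations_def)
  then show ?thesis using one by (auto simp: mult_subgroup_def dilations_def)
qed

text \<open>\<open>1\<close> and \<open>x\<close> are linearly independent over \<open>K\<close>,
  since a relation would put \<open>x\<close> into \<open>K\<close>; counting pairs shows that they
  span.\<close>

lemma coordinates:
  assumes x: "x \<notin> K"
  obtains \<alpha> \<beta> where "\<alpha> \<in> K" "\<beta> \<in> K" "y = \<alpha> * x + \<beta>"
proof -
  let ?f = "\<lambda>(\<alpha>, \<beta>). \<alpha> * x + \<beta>"
  have inj: "inj_on ?f (K \<times> K)"
  proof (rule inj_onI, clarsimp)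
    fix a b c d assume K: "a \<in> K" "b \<in> K" "c \<in> K" "d \<in> K" and eq: "a * x + b = c * x + d"
    have "a = c"
    proof (rule ccontr)
      assume "a \<noteq> c"
      with eq have "x = (d - b) / (a - c)" by (simp add: field_simps)
      with x show False using K by (metis diff divide)
    qed
    with eq show "a = c \<and> b = d" by simp
  qed
  have "?f ` (K \<times> K) = UNIV"
    by (rule card_subset_eq)
      (simp_all add: card_image[OF inj] card_cartesian_product card_UNIV power2_eq_square)
  then have "y \<in> ?f ` (K \<times> K)" by simp
  then show ?thesis using that by auto
qed

lemma directions_uminus: "directions K S \<Longrightarrow> s \<in> S \<Longrightarrow> - s \<in> S"
  using neg[OF one] by (fastforce simp: directions_def dest: bspec[of _ _ "- 1"])

text \<open>A line through \<open>x\<close> not parallel to \<open>K\<close> meets \<open>K\<close>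
  in exactly one point, so every coset in \<open>S\<close> other than \<open>K - {0}\<close>
  contains exactly one \<open>x - k\<close>. This gives the \<open>m - 1\<close> points of
  \<open>K\<close> collinear with \<open>x\<close>.\<close>

lemma card_directions:
  assumes S: "directions K S" and "1 \<in> S" and x: "x \<notin> K"
  shows "card S = (card {k \<in> K. x - k \<in> S} + 1) * (card K - 1)"
proof -
  let ?T = "{k \<in> K. x - k \<in> S}" and ?f = "\<lambda>(k, u). (x - k) * u"
  have KS: "K - {0} \<subseteq> S" using S \<open>1 \<in> S\<close> by (fastforce simp: directions_def)
  have inj: "inj_on ?f (?T \<times> (K - {0}))"
  proof (rule inj_onI)
    fix p q assume "p \<in> ?T \<times> (K - {0})" "q \<in> ?T \<times> (K - {0})" "?f p = ?f q"
    then obtain k l u v where pq: "p = (k, u)" "q = (l, v)"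
      and *: "k \<in> K" "l \<in> K" "u \<in> K" "v \<in> K" "u \<noteq> 0" "(x - k) * u = (x - l) * v" by auto
    have "u = v"
    proof (rule ccontr)
      assume "u \<noteq> v"
      with *(6) have "x = (k * u - l * v) / (u - v)" by (simp add: field_simps)
      with x * show False by (simp add: closed)
    qed
    with * pq show "p = q" by simp
  qed
  have S_eq: "S = (K - {0}) \<union> ?f ` (?T \<times> (K - {0}))"
  proof (intro equalityI subsetI)
    fix s assume s: "s \<in> S"
    obtain a b where ab: "a \<in> K" "b \<in> K" "s = a * x + b" by (rule coordinates[OF x])
    show "s \<in> (K - {0}) \<union> ?f ` (?T \<times> (K - {0}))"
    proof (cases "a = 0")
      case True
      then show ?thesis using ab s S by (auto simp: directions_def)
    next
      case False
      have "1 / a \<in> K - {0}" using False ab one divide by simp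
      then have "s * (1 / a) \<in> S" using s S unfolding directions_def by blast
      moreover have "s * (1 / a) = x - - b / a" using False ab by (simp add: field_simps)
      ultimately have "- b / a \<in> ?T" using ab by (simp add: closed)
      moreover have "s = (x - - b / a) * a" using False ab by (simp add: field_simps)
      ultimately show ?thesis using False ab by (intro UnI2 image_eqI[of _ _ "(- b / a, a)"]) auto
    qed
  qed (use S KS in \<open>auto simp: directions_def\<close>)
  have "(K - {0}) \<inter> ?f ` (?T \<times> (K - {0})) = {}"
  proof -
    have False if "k \<in> K" "u \<in> K" "u \<noteq> 0" "(x - k) * u \<in> K" for k u
    proof -
      have "x = (x - k) * u / u + k" using that by simp
      then show False using x that add divide by metis
    qed
    then show ?thesis by auto
  qed
  then have "card S = card (K - {0}) + card (?f ` (?T \<times> (K - {0})))"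
    by (subst S_eq) (rule card_Un_disjoint, auto)
  also have "\<dots> = (card ?T + 1) * (card K - 1)"
    by (subst card_image[OF inj]) (simp add: card_cartesian_product card_K)
  finally show ?thesis .
qed

text \<open>Trades the family of \<open>m\<close> cosets for a count: the cosets are disjoint and
  have \<open>card K - 1 > 0\<close> elements each, so \<open>card S\<close> determines their
  number.\<close>

lemma desarguesian_net_iff:
  "desarguesian_net r m K S \<longleftrightarrow>
    card K = r \<and> directions K S \<and> card S = m * (r - 1)"
proof -
  have K: "subfield K (ring_of_type_algebra :: 'a ring)"
    unfolding subfield_ring_of_type_algebra_iff by (simp add: closed)
  have cosets: "unit_cosets K = {(*) d ` (K - {0}) | d. d \<noteq> 0}"
    by (simp add: unit_cosets_def)
  have *: "(\<exists>\<C>\<subseteq>unit_cosets K. card \<C> = m \<and> S = \<Union>\<C>) \<longleftrightarrow>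
      directions K S \<and> card S = m * (card K - 1)"
  proof safe
    fix \<C> assume C: "\<C> \<subseteq> unit_cosets K"
    show "card (\<Union>\<C>) = card \<C> * (card K - 1)"
      using card_Union_cosets[OF mult_subgroup_K, of \<C>] C by (simp add: cosets card_K)
    have *: "\<exists>d. d \<noteq> 0 \<and> c = (*) d ` (K - {0})" if "c \<in> \<C>" for c
      using that C unfolding cosets by blast
    show "directions K (\<Union>\<C>)"
      unfolding directions_def
    proof (intro conjI ballI)
      show "0 \<notin> \<Union>\<C>" using * by fastforce
      fix s k assume "s \<in> \<Union>\<C>" and k: "k \<in> K - {0}"
      then obtain c where c: "c \<in> \<C>" "s \<in> c" by blast
      then have "c = (*) s ` (K - {0})" using * coset_eq[OF mult_subgroup_K] by metis
      then show "s * k \<in> \<Union>\<C>" using c(1) k by blast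
    qed
  next
    assume S: "directions K S" "card S = m * (card K - 1)"
    let ?C = "(\<lambda>a. (*) a ` (K - {0})) ` S"
    have sub: "?C \<subseteq> unit_cosets K" using S unfolding cosets directions_def by blast
    have U: "\<Union>?C = S"
      by (rule Union_own_cosets[OF mult_subgroup_K]) (use S in \<open>auto simp: directions_def\<close>)
    have "card K - 1 \<noteq> 0" using card_K_gt_1 by simp
    then have "card ?C = m"
      using card_Union_cosets[OF mult_subgroup_K, of ?C] sub S(2) unfolding U
      by (simp add: cosets card_K)
    then show "\<exists>\<C>\<subseteq>unit_cosets K. card \<C> = m \<and> S = \<Union>\<C>"
      using sub U by blast
  qed
  show ?thesis using * K card_UNIV by (auto simp: desarguesian_net_def)
qed

section \<open>Size of the clique of a line and a point\<close>

lemma card_net_clique: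
  assumes S: "directions K S" and d: "d \<in> S" and x: "x \<notin> K"
    and T_def: "T = {k \<in> K. d * (x - k) \<in> S}"
    and sum0: "\<Sum>T = 0" and nz: "of_nat (card T) \<noteq> (0::'a)"
  shows "card (net_clique S (a + d * x) ((\<lambda>k. a + d * k) ` K)) =
    card T + (if 0 \<in> T then card (dilations K T) else 1)"
proof -
  let ?\<phi> = "\<lambda>z. a + d * z"
  \<comment> \<open>The multiples \<open>u * x\<close> with \<open>u\<close> in \<open>U\<close>
    will be the clique points off the line; for \<open>0 \<notin> T\<close> only \<open>x\<close>
    itself remains.\<close>
  define U where "U = (if 0 \<in> T then dilations K T else {1})"
  define M where "M = T \<union> (\<lambda>u. u * x) ` U"
  have d0: "d \<noteq> 0" using S d by (auto simp: directions_def)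
  have S_mult: "d * (z * k) \<in> S" if "d * z \<in> S" "k \<in> K" "k \<noteq> 0" for z k
    using S that by (auto simp: directions_def mult.assoc[symmetric])
  have S_neg: "d * (z - w) \<in> S" if "d * (w - z) \<in> S" for w z
    using directions_uminus[OF S that] by (simp add: algebra_simps)
  have S_K: "d * k \<in> S" if "k \<in> K" "k \<noteq> 0" for k
    using S_mult[of 1 k] d that by simp
  have T: "t \<in> K" "d * (x - t) \<in> S" if "t \<in> T" for t using that by (auto simp: T_def)
  have U: "mult_subgroup U" "U \<subseteq> K - {0}"
    using mult_subgroup_dilations one by (auto simp: U_def mult_subgroup_def dilations_def)
  have U_T: "t * u \<in> T" if "u \<in> U" "t \<in> T" for u t
    using that by (auto simp: U_def dilations_def split: if_splits)
  have Ux_T: "d * (u * x - t) \<in> S" if "u \<in> U" "t \<in> T" for u t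
  proof -
    have u: "u \<in> K" "u \<noteq> 0" using U that by auto
    \<comment> \<open>\<open>u * x - t\<close> is \<open>u\<close> times \<open>x - t / u\<close>,
      and \<open>t / u\<close> is again in \<open>T\<close>.\<close>
    have "t * inverse u \<in> T" using U_T[OF mult_subgroupD(4)[OF U(1)]] that by blast
    then have "d * ((x - t * inverse u) * u) \<in> S" using S_mult T(2) u by blast
    moreover have "(x - t * inverse u) * u = u * x - t" using u by (simp add: field_simps)
    ultimately show ?thesis by simp
  qed
  have Ux_Ux: "d * (u * x - v * x) \<in> S" if "u \<in> U" "v \<in> U" "u \<noteq> v" for u v
  proof -
    \<comment> \<open>\<open>U\<close> has two distinct elements only in the case
      \<open>0 \<in> T\<close>; then the points \<open>u * x\<close> lie on the line through
      \<open>0\<close> and \<open>x\<close>.\<close>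
    have "0 \<in> T" using that by (auto simp: U_def split: if_splits)
    then have "d * x \<in> S" using T(2)[of 0] by simp
    moreover have "u - v \<in> K" "u - v \<noteq> 0" using that U diff by auto
    ultimately have "d * (x * (u - v)) \<in> S" using S_mult by blast
    then show ?thesis by (simp add: algebra_simps)
  qed
  have M_clique: "d * (y - z) \<in> S" if "y \<in> M" "z \<in> M" "y \<noteq> z" for y z
    using that S_neg S_K[OF diff] T(1) Ux_T Ux_Ux unfolding M_def by auto
  have Q: "{?\<phi> x} \<union> (perp S (?\<phi> x) \<inter> ?\<phi> ` K) = ?\<phi> ` insert x T"
  proof -
    have "?\<phi> k \<in> perp S (?\<phi> x) \<longleftrightarrow> k \<in> T" if k: "k \<in> K" for k
    proof -
      have "k \<noteq> x" using k x by auto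
      moreover have "a + d * x - (a + d * k) = d * (x - k)" by (simp add: algebra_simps)
      ultimately show ?thesis
        using k d0 collinearity_edges_iff[of S, OF directions_uminus[OF S]]
        by (simp add: perp_def T_def)
    qed
    then have "perp S (?\<phi> x) \<inter> ?\<phi> ` K = ?\<phi> ` T" using T(1) by blast
    then show ?thesis by simp
  qed
  have M_max: "z \<in> M" if z: "\<And>q. q \<in> insert x T \<Longrightarrow> z \<noteq> q \<Longrightarrow> d * (z - q) \<in> S" for z
  proof -
    obtain \<alpha> \<beta> where K: "\<alpha> \<in> K" "\<beta> \<in> K" and z_eq: "z = \<alpha> * x + \<beta>" by (rule coordinates[OF x])
    show ?thesis
    proof (cases "\<alpha> = 0")
      case True
      then have "z \<in> K" "z \<noteq> x" using K x z_eq by auto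
      then have "z \<in> T" using S_neg[OF z[of x]] by (simp add: T_def)
      then show ?thesis by (simp add: M_def)
    next
      case False
      have "z \<notin> K"
      proof
        assume "z \<in> K"
        moreover have "x = (z - \<beta>) / \<alpha>" using False z_eq by simp
        ultimately show False using x K by (simp add: closed)
      qed
      \<comment> \<open>Dividing \<open>z - t\<close> by \<alpha> preserves collinearity and gives
        \<open>x - (t - \<beta>) / \<alpha>\<close>.\<close>
      have T_affine: "(t - \<beta>) / \<alpha> \<in> T" if t: "t \<in> T" for t
      proof -
        have "d * (z - t) \<in> S" using z t T(1)[OF t] \<open>z \<notin> K\<close> by blast
        then have "d * ((z - t) * (1 / \<alpha>)) \<in> S" using S_mult[of _ "1 / \<alpha>"] K False one divide by simp
        moreover have "(z - t) * (1 / \<alpha>) = x - (t - \<beta>) / \<alpha>"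
          using False z_eq by (simp add: field_simps)
        ultimately have "d * (x - (t - \<beta>) / \<alpha>) \<in> S" by (simp only:)
        moreover have "(t - \<beta>) / \<alpha> \<in> K" using T(1)[OF t] K diff divide by blast
        ultimately show ?thesis unfolding T_def by blast
      qed
      have inj: "inj_on (\<lambda>t. (t - \<beta>) / \<alpha>) T" using False by (auto simp: inj_on_def)
      then have "(\<lambda>t. (t - \<beta>) / \<alpha>) ` T = T"
        using T_affine by (intro endo_inj_surj) auto
      \<comment> \<open>\<open>T\<close> and its affine image have the same sum \<open>0\<close>, so
        \<open>card T\<close> times \<beta> vanishes, and \<open>nz\<close> forces
        \<open>\<beta> = 0\<close>.\<close>
      then have "\<Sum>T = (\<Sum>t\<in>T. (t - \<beta>) / \<alpha>)" using sum.reindex[OF inj, of "\<lambda>t. t"] by simp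
      also have "\<dots> = (\<Sum>T - of_nat (card T) * \<beta>) / \<alpha>"
        by (simp add: sum_subtractf flip: sum_divide_distrib)
      finally have "\<beta> = 0" using sum0 nz False by simp
      then have "inverse \<alpha> \<in> dilations K T"
        using T_affine False K divide[OF one] by (simp add: dilations_def divide_inverse)
      then have dil: "\<alpha> \<in> dilations K T"
        using mult_subgroupD(4)[OF mult_subgroup_dilations] by fastforce
      \<comment> \<open>For \<open>\<alpha> \<noteq> 1\<close>, dividing the difference of
        \<open>\<alpha> * x\<close> and \<open>x\<close> by \<open>\<alpha> - 1\<close> gives
        \<open>d * x \<in> S\<close>, that is, \<open>0 \<in> T\<close>.\<close>
      have "\<alpha> \<in> U"
      proof (cases "\<alpha> = 1")
        case False
        then have "z \<noteq> x" using x zero z_eq \<open>\<beta> = 0\<close> by auto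
        then have "d * (\<alpha> * x - x) \<in> S" using z[of x] z_eq \<open>\<beta> = 0\<close> by simp
        then have "d * ((\<alpha> * x - x) * (1 / (\<alpha> - 1))) \<in> S"
          using S_mult[of _ "1 / (\<alpha> - 1)"] K False by (simp add: closed)
        moreover have "(\<alpha> * x - x) * (1 / (\<alpha> - 1)) = x" using False by (simp add: field_simps)
        ultimately have "d * x \<in> S" by (simp only:)
        then have "0 \<in> T" using zero by (simp add: T_def)
        then show ?thesis using dil by (simp add: U_def)
      qed (use mult_subgroupD(1)[OF U(1)] in simp)
      then have "\<alpha> * x \<in> (\<lambda>u. u * x) ` U" by (rule imageI)
      then show ?thesis using z_eq \<open>\<beta> = 0\<close> by (simp add: M_def)
    qed
  qed
  have "net_clique S (?\<phi> x) (?\<phi> ` K) = ?\<phi> ` M"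
  proof (rule net_clique_eqI)
    show "- s \<in> S" if "s \<in> S" for s using directions_uminus[OF S that] .
    show "y - z \<in> S" if "y \<in> ?\<phi> ` M" "z \<in> ?\<phi> ` M" "y \<noteq> z" for y z
      using that M_clique by (auto simp: right_diff_distrib)
    have "x \<in> M" using mult_subgroupD(1)[OF U(1)] by (auto simp: M_def intro: image_eqI[of _ _ 1])
    then show "{?\<phi> x} \<union> (perp S (?\<phi> x) \<inter> ?\<phi> ` K) \<subseteq> ?\<phi> ` M"
      unfolding Q by (auto simp: M_def)
    fix y assume y: "\<And>q. q \<in> {?\<phi> x} \<union> (perp S (?\<phi> x) \<inter> ?\<phi> ` K) \<Longrightarrow> y \<noteq> q \<Longrightarrow> y - q \<in> S"
    have y_eq: "y = ?\<phi> ((y - a) / d)" using d0 by simp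
    have "(y - a) / d \<in> M"
    proof (rule M_max)
      fix q assume "q \<in> insert x T" "(y - a) / d \<noteq> q"
      moreover from this have "y \<noteq> ?\<phi> q" using d0 by auto
      ultimately have "y - ?\<phi> q \<in> S" using y unfolding Q by blast
      moreover have "d * ((y - a) / d - q) = y - ?\<phi> q" using d0 by (subst right_diff_distrib) simp
      ultimately show "d * ((y - a) / d - q) \<in> S" by simp
    qed
    then show "y \<in> ?\<phi> ` M" using y_eq by blast
  qed
  then have "card (net_clique S (?\<phi> x) (?\<phi> ` K)) = card M"
    using d0 by (simp add: card_image inj_on_def)
  also have "\<dots> = card T + card U"
  proof -
    have "x \<noteq> 0" using x zero by auto
    have "u * x \<notin> T" if "u \<in> U" for u
    proof
      assume "u * x \<in> T"
      then have "u * x / u \<in> K" using T(1) U(2) that divide by blast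
      moreover have "u \<noteq> 0" using that U(2) by auto
      ultimately show False using x by simp
    qed
    then have "T \<inter> (\<lambda>u. u * x) ` U = {}" by auto
    moreover have "card ((\<lambda>u. u * x) ` U) = card U"
      using \<open>x \<noteq> 0\<close> by (simp add: card_image inj_on_def)
    ultimately show ?thesis unfolding M_def by (simp add: card_Un_disjoint)
  qed
  finally show ?thesis by (simp add: U_def)
qed

text \<open>Brings an arbitrary line and point into the position of \<open>card_net_clique\<close>,
  with the origin of the line at the barycentre. If \<open>0\<close> is not in the normalised set,
  \<open>h\<close> is \<open>1\<close>.\<close>

lemma card_net_clique_dvd:
  assumes net: "desarguesian_net r m K S" and L: "L \<in> net_lines K S" and x: "x \<notin> L"
    and m: "m \<ge> 1" and nz: "of_nat (m - 1) \<noteq> (0::'a)"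
  obtains h where "card (net_clique S x L) = m - 1 + h" "h dvd gcd (r - 1) (m - 2)"
proof -
  have r: "card K = r" and S: "directions K S" and card_S: "card S = m * (r - 1)"
    using net desarguesian_net_iff by auto
  obtain b d where d: "d \<in> S" and L_eq: "L = (\<lambda>k. b + d * k) ` K"
    using L by (auto simp: net_lines_def)
  have d0: "d \<noteq> 0" using S d by (auto simp: directions_def)
  define y where "y = (x - b) / d"
  have x_eq: "x = b + d * y" using d0 by (simp add: y_def)
  then have y: "y \<notin> K" using x L_eq by blast
  define T where "T = {k \<in> K. d * (y - k) \<in> S}"
  have card_T: "card T = m - 1"
  proof -
    \<comment> \<open>Dividing all directions by \<open>d\<close> makes \<open>1\<close> a
      direction, as \<open>card_directions\<close> demands.\<close>
    let ?S = "{s. d * s \<in> S}"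
    have "(*) d ` ?S = S" using d0 by (auto intro!: image_eqI[of s _ "s / d" for s])
    then have "card ?S = m * (r - 1)"
      using card_S d0 card_image[of "(*) d" ?S] by (simp add: inj_on_def)
    moreover have "card ?S = (card T + 1) * (r - 1)"
      using card_directions[OF _ _ y, of ?S] S d r
      by (simp add: directions_def T_def mult.assoc[symmetric])
    ultimately have "card T + 1 = m" using card_K_gt_1 r by (metis mult_cancel2 zero_less_diff less_irrefl)
    then show ?thesis by simp
  qed
  \<comment> \<open>The barycentre of \<open>T\<close>, a genuine quotient because
    \<open>m - 1\<close> is nonzero in the field.\<close>
  define c where "c = \<Sum>T / of_nat (card T)"
  have c: "c \<in> K" unfolding c_def by (intro divide sum of_nat) (simp add: T_def)
  let ?T = "{k \<in> K. d * (y - c - k) \<in> S}"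
  have T_shift: "?T = (\<lambda>k. k - c) ` T"
  proof (intro equalityI subsetI)
    fix k assume "k \<in> ?T"
    then have "k + c \<in> T" using c add by (simp add: T_def algebra_simps)
    then show "k \<in> (\<lambda>k. k - c) ` T" by (intro image_eqI[of _ _ "k + c"]) simp_all
  qed (use c diff in \<open>auto simp: T_def\<close>)
  have card_T': "card ?T = m - 1" unfolding T_shift using card_T by (simp add: card_image inj_on_def)
  have "\<Sum>?T = (\<Sum>k\<in>T. k - c)" unfolding T_shift by (subst sum.reindex) (auto simp: inj_on_def)
  also have "\<dots> = 0" using nz card_T by (simp add: sum_subtractf c_def)
  finally have sum0: "\<Sum>?T = 0" .
  have yc: "y - c \<notin> K" using add[OF _ c] y by fastforce
  have "L = (\<lambda>k. b + d * c + d * k) ` K"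
  proof -
    have "(\<lambda>k. k + c) ` K = K"
      using c add by (intro endo_inj_surj) (auto simp: inj_on_def)
    then have "L = (\<lambda>k. b + d * k) ` (\<lambda>k. k + c) ` K" using L_eq by simp
    then show ?thesis by (simp add: image_image algebra_simps)
  qed
  moreover have "x = b + d * c + d * (y - c)" using x_eq by (simp add: algebra_simps)
  ultimately have "card (net_clique S x L) =
      card ?T + (if 0 \<in> ?T then card (dilations K ?T) else 1)"
    using card_net_clique[OF S d yc refl sum0] nz card_T' by simp
  moreover have "card (dilations K ?T) dvd gcd (r - 1) (m - 2)" if "0 \<in> ?T"
  proof (rule gcd_greatest)
    have "card (dilations K ?T) dvd card (K - {0})"
      by (rule card_mult_subgroup_dvd[OF mult_subgroup_dilations])
        (auto simp: dilations_def intro: mult)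
    then show "card (dilations K ?T) dvd r - 1" using r card_K by simp
    \<comment> \<open>Dilations fix \<open>0\<close>, so they act freely on the other
      \<open>m - 2\<close> points.\<close>
    have "card (dilations K ?T) dvd card (?T - {0})"
      by (rule card_mult_subgroup_dvd[OF mult_subgroup_dilations]) (auto simp: dilations_def)
    then show "card (dilations K ?T) dvd m - 2"
      using that card_T' by (simp add: card_Diff_singleton numeral_2_eq_2)
  qed
  ultimately show ?thesis
    using that[of "if 0 \<in> ?T then card (dilations K ?T) else 1"] card_T' by simp
qed

lemma net_clique_exists:
  assumes T: "T \<subseteq> K" and sum0: "\<Sum>T = 0" and nz: "of_nat (card T) \<noteq> (0::'a)"
  obtains S L x where "desarguesian_net (card K) (card T + 1) K S" "L \<in> net_lines K S" "x \<notin> L"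
    "card (net_clique S x L) = card T + (if 0 \<in> T then card (dilations K T) else 1)"
proof -
  have "K \<noteq> UNIV" using card_UNIV card_K_gt_1 by (auto simp: power2_eq_square)
  then obtain x where x: "x \<notin> K" by blast
  define S where "S = (K - {0}) \<union> {(x - t) * u | t u. t \<in> T \<and> u \<in> K - {0}}"
  have S: "directions K S"
    unfolding directions_def
  proof (intro conjI ballI)
    show "0 \<notin> S" using x T by (auto simp: S_def)
    fix s k assume s: "s \<in> S" and k: "k \<in> K - {0}"
    consider "s \<in> K - {0}" | t u where "t \<in> T" "u \<in> K - {0}" "s = (x - t) * u"
      using s by (auto simp: S_def)
    then show "s * k \<in> S"
    proof cases
      case 2
      then have "s * k = (x - t) * (u * k)" "u * k \<in> K - {0}" using k mult by auto
      then show ?thesis unfolding S_def using 2(1) by blast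
    qed (use k mult in \<open>simp add: S_def\<close>)
  qed
  have 1: "1 \<in> S" using one by (simp add: S_def)
  have T_eq: "{k \<in> K. x - k \<in> S} = T"
  proof (intro equalityI subsetI)
    fix k assume "k \<in> {k \<in> K. x - k \<in> S}"
    then have k: "k \<in> K" "x - k \<in> S" by auto
    have "x - k \<notin> K" using add[OF _ k(1)] x by fastforce
    then obtain t u where tu: "t \<in> T" "u \<in> K" "x - k = (x - t) * u"
      using k(2) by (auto simp: S_def)
    \<comment> \<open>No further point of \<open>K\<close> becomes collinear with \<open>x\<close>:
      for \<open>u \<noteq> 1\<close> the equation could be solved for \<open>x\<close> within
      \<open>K\<close>.\<close>
    have "u = 1"
    proof (rule ccontr)
      assume "u \<noteq> 1"
      with tu(3) have "x = (k - t * u) / (1 - u)" by (simp add: field_simps)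
      moreover have "(k - t * u) / (1 - u) \<in> K"
        using tu T k one by (intro divide diff mult) auto
      ultimately show False using x by simp
    qed
    then show "k \<in> T" using tu by simp
  next
    fix t assume "t \<in> T"
    then have "x - t = (x - t) * 1" "1 \<in> K - {0}" "t \<in> T" using one by auto
    then show "t \<in> {k \<in> K. x - k \<in> S}" unfolding S_def using T by blast
  qed
  have net: "desarguesian_net (card K) (card T + 1) K S"
    using card_directions[OF S 1 x] S by (simp add: desarguesian_net_iff T_eq)
  have "(\<lambda>k. 0 + 1 * k) ` K \<in> net_lines K S" using 1 unfolding net_lines_def by blast
  moreover have "card (net_clique S (0 + 1 * x) ((\<lambda>k. 0 + 1 * k) ` K)) =
      card T + (if 0 \<in> T then card (dilations K T) else 1)"
    by (rule card_net_clique[OF S 1 x _ sum0 nz]) (simp add: T_eq)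
  ultimately show ?thesis using that[OF net, of K x] x by simp
qed

section \<open>Subsets of a field with sum zero and prescribed dilations\<close>

lemma ex_in_K_not_in:
  assumes "card B < card K"
  obtains u where "u \<in> K" "u \<notin> B"
proof -
  have "\<not> K \<subseteq> B" using card_mono[of B K] assms by fastforce
  then show ?thesis using that by blast
qed

text \<open>Multiplication by some \<open>u\<close> other than \<open>0\<close> and \<open>1\<close>
  permutes \<open>K\<close>, so the sum equals \<open>u\<close> times itself. For two elements the
  sum would be \<open>1\<close>.\<close>

lemma sum_K:
  assumes "card K > 2"
  shows "\<Sum>K = 0"
proof -
  obtain u where u: "u \<in> K" "u \<notin> {0, 1}" using ex_in_K_not_in[of "{0, 1}"] assms by auto
  then have inj: "inj_on ((*) u) K" by (simp add: inj_on_def)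
  have "(*) u ` K = K" using u mult by (intro endo_inj_surj inj) auto
  then have "\<Sum>K = (\<Sum>x\<in>K. u * x)" using sum.reindex[OF inj, of "\<lambda>x. x"] by simp
  also have "\<dots> = u * \<Sum>K" by (simp add: sum_distrib_left)
  finally have "(u - 1) * \<Sum>K = 0" by (simp add: algebra_simps)
  then show ?thesis using u by simp
qed

text \<open>
  All but two elements are chosen freely. The last two are \<open>u\<close> and \<open>\<sigma> - u\<close>, where
  \<open>- \<sigma>\<close> is the sum of the others; in characteristic \<open>2\<close> they are distinct only if \<open>\<sigma> \<noteq> 0\<close>, which
  is why at least one free choice is needed there.
\<close>

lemma zero_sum_subset:
  assumes k: "k \<ge> 2" "2 * k < card K" and two: "(1 + 1 :: 'a) \<noteq> 0 \<or> k \<ge> 3"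
  obtains T where "T \<subseteq> K - {0}" "card T = k" "\<Sum>T = 0"
proof -
  obtain A where A: "A \<subseteq> K - {0}" "card A = k - 2" "(1 + 1 :: 'a) \<noteq> 0 \<or> \<Sum>A \<noteq> 0"
  proof -
    have "k - 2 \<le> card (K - {0})" using k by (simp add: card_K)
    then obtain B where B: "B \<subseteq> K - {0}" "card B = k - 2" by (rule obtain_subset_with_card_n)
    show ?thesis
    proof (cases "(1 + 1 :: 'a) \<noteq> 0 \<or> \<Sum>B \<noteq> 0")
      case False
      then obtain b where b: "b \<in> B" using two B k by fastforce
      have "card (insert 0 B) \<le> Suc (card B)" by (simp add: card_insert_if)
      then have "card (insert 0 B) < card K" using B k by linarith
      then obtain c where c: "c \<in> K" "c \<notin> insert 0 B" by (rule ex_in_K_not_in)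
      \<comment> \<open>Exchanging \<open>b\<close> for a new \<open>c\<close> turns the sum
        \<open>0\<close> into a nonzero one.\<close>
      have "\<Sum>(insert c (B - {b})) = c - b" using b c False by (simp add: sum_diff1)
      moreover have "card (insert c (B - {b})) = k - 2"
        using B b c card_Suc_Diff1[of B b] by (simp add: card_insert_if)
      ultimately show ?thesis using that[of "insert c (B - {b})"] B b c by auto
    qed (use that B in blast)
  qed
  define \<sigma> where "\<sigma> = - \<Sum>A"
  let ?A = "insert 0 A"
  \<comment> \<open>The values of \<open>u\<close> for which \<open>u\<close> and
    \<open>\<sigma> - u\<close> coincide: at most one when doubling is injective, none in
    characteristic 2 because \<open>\<sigma> \<noteq> 0\<close>. In all, at most
    \<open>2 * k - 1\<close> values are forbidden.\<close>
  let ?D = "{u. u + u = \<sigma>}"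
  have card_A: "card ?A = k - 1" using A k by (subst card_insert_disjoint) auto
  have "card ?D \<le> 1"
  proof -
    have "u = v" if "u \<in> ?D" "v \<in> ?D" for u v
    proof -
      have "(1 + 1) * (u - v) = 0" using that by (simp add: algebra_simps)
      moreover have "(1 + 1 :: 'a) \<noteq> 0"
      proof
        assume "(1 + 1 :: 'a) = 0"
        moreover from this have "(1 + 1) * u = 0" by simp
        ultimately show False using that A(3) by (simp add: distrib_right \<sigma>_def)
      qed
      ultimately show ?thesis by simp
    qed
    then show ?thesis by (simp add: card_le_Suc0_iff_eq)
  qed
  moreover have "card ((\<lambda>a. \<sigma> - a) ` ?A) \<le> k - 1"
    using card_image_le[of ?A "\<lambda>a. \<sigma> - a"] card_A by (simp only: finite)
  moreover have "card (?A \<union> (\<lambda>a. \<sigma> - a) ` ?A \<union> ?D) \<le> card ?A + card ((\<lambda>a. \<sigma> - a) ` ?A) + card ?D"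
    by (intro order.trans[OF card_Un_le] add_mono card_Un_le order.refl)
  ultimately have "card (?A \<union> (\<lambda>a. \<sigma> - a) ` ?A \<union> ?D) \<le> (k - 1) + (k - 1) + 1"
    using card_A by linarith
  then have "card (?A \<union> (\<lambda>a. \<sigma> - a) ` ?A \<union> ?D) < card K" using k by linarith
  then obtain u where u: "u \<in> K" "u \<notin> ?A \<union> (\<lambda>a. \<sigma> - a) ` ?A \<union> ?D" by (rule ex_in_K_not_in)
  have v: "\<sigma> - u \<notin> ?A"
  proof
    assume "\<sigma> - u \<in> ?A"
    then have "\<sigma> - (\<sigma> - u) \<in> (\<lambda>a. \<sigma> - a) ` ?A" by (rule imageI)
    then show False using u by simp
  qed
  have "\<sigma> \<in> K" unfolding \<sigma>_def using A by (intro neg sum) auto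
  then have sub: "insert u (insert (\<sigma> - u) A) \<subseteq> K - {0}" using u v A diff by auto
  have uv: "u \<noteq> \<sigma> - u" using u by auto
  have "card (insert u (insert (\<sigma> - u) A)) = k" using u v uv A k by simp
  moreover have "\<Sum>(insert u (insert (\<sigma> - u) A)) = 0" using u v uv by (simp add: \<sigma>_def)
  ultimately show ?thesis using that sub by blast
qed

text \<open>A permutation of \<open>K\<close> preserving \<open>T\<close> preserves its complement.
  One inclusion suffices, as complementation is an involution.\<close>

lemma dilations_Diff:
  assumes "T \<subseteq> K"
  shows "dilations K (K - T) = dilations K T"
proof -
  have *: "dilations K T \<subseteq> dilations K (K - T)" if "T \<subseteq> K" for T
  proof
    fix u assume u: "u \<in> dilations K T"
    then have u': "u \<noteq> 0" "u \<in> K" by (auto simp: dilations_def)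
    have inv: "inverse u \<in> dilations K T"
      using u mult_subgroupD(4)[OF mult_subgroup_dilations] by blast
    have "t * u \<in> K - T" if "t \<in> K - T" for t
    proof -
      have "t * u * inverse u \<in> T" if "t * u \<in> T" using inv that unfolding dilations_def by blast
      then show ?thesis using that u' mult by (auto simp: mult.assoc)
    qed
    then show "u \<in> dilations K (K - T)" using u' by (simp add: dilations_def)
  qed
  show ?thesis using *[of T] *[of "K - T"] assms by (simp add: double_diff)
qed

text \<open>
  Large sets are complements in \<open>K - {0}\<close> of small ones. This breaks down only for
  \<open>card K = n + 3\<close> in characteristic \<open>2\<close>, as two distinct elements never sum to \<open>0\<close> there; in that
  case \<open>T = K - {1, b, 1 + b}\<close>, where \<open>b\<close> is not a primitive cube root of unity.
\<close>

lemma zero_sum_no_dilations: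
  assumes n: "2 \<le> n" "n + 3 \<le> card K"
    and two: "(1 + 1 :: 'a) = 0 \<Longrightarrow> odd n \<and> even (card K)"
  obtains T where "T \<subseteq> K" "card T = n" "\<Sum>T = 0" "0 \<notin> T \<or> card (dilations K T) = 1"
proof -
  let ?k = "card K - 1 - n"
  consider "2 * n < card K" | "card K \<le> 2 * n" "(1 + 1 :: 'a) \<noteq> 0 \<or> ?k \<ge> 3"
    | "(1 + 1 :: 'a) = 0" "card K = n + 3"
    using n by linarith
  then show ?thesis
  proof cases
    case 1
    have "(1 + 1 :: 'a) \<noteq> 0 \<or> n \<ge> 3" using two n by (cases "n = 2") auto
    then obtain T where "T \<subseteq> K - {0}" "card T = n" "\<Sum>T = 0"
      using zero_sum_subset 1 n by blast
    then show ?thesis using that[of T] by auto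
  next
    case 2
    have "2 \<le> ?k" "2 * ?k < card K" using n 2 by linarith+
    then obtain T where T: "T \<subseteq> K - {0}" "card T = ?k" "\<Sum>T = 0"
      using zero_sum_subset 2 by blast
    then have "card (K - {0} - T) = n" using n by (simp add: card_Diff_subset card_K)
    moreover have "\<Sum>(K - {0} - T) = 0"
      using T sum_K n zero by (simp add: sum_diff sum_diff1)
    ultimately show ?thesis using that[of "K - {0} - T"] by auto
  next
    case 3
    have double: "x + x = 0" for x :: 'a
    proof -
      have "(1 + 1) * x = 0" using 3 by simp
      then show ?thesis by (simp add: distrib_right)
    qed
    then have minus: "- x = x" for x :: 'a by (rule minus_unique)
    let ?roots = "{b. b * b + b + 1 = (0::'a)}"
    have "card ?roots \<le> 2"
    proof (cases "?roots = {}")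
      case False
      then obtain w where "w \<in> ?roots" by blast
      then have w: "w * w + w + 1 = 0" by simp
      have "?roots \<subseteq> {w, - 1 - w}"
      proof
        fix b assume "b \<in> ?roots"
        then have "b * b + b + 1 - (w * w + w + 1) = 0" using w by simp
        then have "(b - w) * (b - (- 1 - w)) = 0" by (simp add: algebra_simps)
        then show "b \<in> {w, - 1 - w}" by simp
      qed
      from card_mono[OF _ this] show ?thesis using card_insert_le_m1[of 2 "{- 1 - w}" w] by simp
    qed simp
    \<comment> \<open>At most four values of \<open>b\<close> are excluded, whereas
      \<open>card K = n + 3\<close> is at least 5.\<close>
    then have "card ({0, 1} \<union> ?roots) < card K"
      using card_Un_le[of "{0, 1}" ?roots] 3 n by simp
    then obtain b where b: "b \<in> K" "b \<notin> {0, 1} \<union> ?roots" by (rule ex_in_K_not_in)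
    let ?N = "{1, b, 1 + b}"
    have N: "?N \<subseteq> K" using b one add by auto
    have "1 + b \<noteq> 0"
    proof
      assume "1 + b = 0"
      then have "b = - 1" by (simp add: eq_neg_iff_add_eq_0 add.commute)
      then show False using b minus[of 1] by simp
    qed
    have "b \<noteq> 1 + b" "1 \<noteq> 1 + b" "1 \<noteq> b" using b by auto
    then have card_N: "card ?N = 3" and sum_N: "\<Sum>?N = (1 + b) + (1 + b)" by simp_all
    \<comment> \<open>As \<open>1\<close> is in \<open>?N\<close>, a dilation \<open>u\<close> lies
      in \<open>?N\<close>. For \<open>u = b\<close> or \<open>u = 1 + b\<close>, the image of
      \<open>b\<close> is in \<open>?N\<close> only if \<open>b\<close> is one of the excluded
      values.\<close>
    have "dilations K ?N = {1}"
    proof (intro equalityI subsetI)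
      fix u assume "u \<in> dilations K ?N"
      then have u: "u \<in> ?N" "b * u \<in> ?N" "(1 + b) * u \<in> ?N" by (auto simp: dilations_def)
      show "u \<in> {1}"
      proof (rule ccontr)
        assume "u \<notin> {1}"
        then consider "u = b" | "u = 1 + b" using u by auto
        then show False
        proof cases
          case 1
          then consider "b * b = 1" | "b * b = b" | "b * b = 1 + b" using u by auto
          then show False
          proof cases
            case 1
            then have "(b - 1) * (b + 1) = 0" by (simp add: algebra_simps)
            then show False using b \<open>1 + b \<noteq> 0\<close> by (simp add: add.commute)
          next
            case 3
            then have "b * b + b + 1 = (1 + b) + (1 + b)" by (simp add: algebra_simps)
            also have "\<dots> = 0" by (rule double)
            finally show False using b by simp
          qed (use b in simp)
        next
          case 2
          then consider "b * b + b = 1" | "b * b + b = b" | "b * b + b = 1 + b"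
            using u(2) by (auto simp: algebra_simps)
          then show False
          proof cases
            case 1
            then have "b * b + b + 1 = 0" using 3(1) by simp
            then show False using b by simp
          next
            case 3
            then have "(b - 1) * (b + 1) = 0" by (simp add: algebra_simps)
            then show False using b \<open>1 + b \<noteq> 0\<close> by (simp add: add.commute)
          qed (use b in simp)
        qed
      qed
    qed (use one in \<open>simp add: dilations_def\<close>)
    then have "card (dilations K (K - ?N)) = 1" using dilations_Diff[OF N] by simp
    moreover have "\<Sum>(K - ?N) = 0"
    proof -
      have "\<Sum>(K - ?N) = \<Sum>K - \<Sum>?N" by (rule sum_diff) (use N in auto)
      also have "\<dots> = 0" unfolding sum_N double using sum_K 3 n by simp
      finally show ?thesis .
    qed
    moreover have "card (K - ?N) = n" using card_Diff_subset[of ?N K] N card_N 3 by simp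
    ultimately show ?thesis using that[of "K - ?N"] by blast
  qed
qed

text \<open>
  The quotient of \<open>K - {0}\<close> by its subgroup of order \<open>h\<close> is cyclic of order \<open>N\<close>, and \<open>s < N\<close>
  consecutive elements of a cyclic group of order \<open>N\<close> are invariant under no translation. So
  \<open>T - {0}\<close> is taken as the union of \<open>s\<close> consecutive cosets.
\<close>

lemma zero_sum_dilations:
  assumes g: "g \<noteq> 0" "K - {0} = range ((^) g)" and order: "\<And>n. g ^ n = 1 \<longleftrightarrow> card K - 1 dvd n"
    and N: "card K - 1 = N * h" and h: "h > 1" and s: "0 < s" "s < N"
  obtains T where "T \<subseteq> K" "card T = s * h + 1" "\<Sum>T = 0" "0 \<in> T" "card (dilations K T) = h"
proof -
  note power_eq = power_eq_power_iff_mod[OF g(1) order, unfolded N]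
  have power_K: "g ^ n \<in> K" "g ^ n \<noteq> 0" for n using g by auto
  \<comment> \<open>\<open>g ^ N\<close> generates the subgroup of order \<open>h\<close>; for fixed
    \<open>i\<close> the index \<open>j\<close> runs through one of its cosets.\<close>
  let ?f = "\<lambda>(j, i). g ^ (N * j + i)"
  define A where "A = ?f ` ({..<h} \<times> {..<s})"
  have bound: "N * j + i < N * h" if "j < h" "i < N" for i j
  proof -
    have "N * j + i < N * (j + 1)" using that by simp
    also have "\<dots> \<le> N * h" using that by (intro mult_le_mono2) simp
    finally show ?thesis .
  qed
  have mem: "g ^ n \<in> A \<longleftrightarrow> n mod N < s" for n
  proof
    assume "g ^ n \<in> A"
    then obtain j i where *: "i < s" "g ^ n = g ^ (N * j + i)" by (auto simp: A_def)
    then have "n mod N = (N * j + i) mod N"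
      unfolding power_eq by (metis dvd_triv_left mod_mod_cancel)
    then show "n mod N < s" using * s by simp
  next
    assume *: "n mod N < s"
    let ?q = "n mod (N * h)"
    have "?q < N * h" using s h by simp
    then have "?q div N < h" by (simp add: less_mult_imp_div_less mult.commute)
    moreover have "?q mod N = n mod N" by (simp add: mod_mod_cancel)
    moreover have "g ^ n = g ^ (N * (?q div N) + ?q mod N)" unfolding power_eq by simp
    ultimately show "g ^ n \<in> A" using * unfolding A_def
      by (intro image_eqI[of _ _ "(?q div N, ?q mod N)"]) auto
  qed
  have inj: "inj_on ?f ({..<h} \<times> {..<s})"
  proof (rule inj_onI)
    fix p q assume "p \<in> {..<h} \<times> {..<s}" "q \<in> {..<h} \<times> {..<s}" "?f p = ?f q"
    then obtain j i j' i' where pq: "p = (j, i)" "q = (j', i')"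
      and *: "j < h" "i < s" "j' < h" "i' < s" "g ^ (N * j + i) = g ^ (N * j' + i')" by auto
    have eq: "N * j + i = N * j' + i'"
      using *(5) bound *(1-4) s unfolding power_eq by simp
    have "j = (N * j + i) div N" "i = (N * j + i) mod N" "j' = (N * j' + i') div N" "i' = (N * j' + i') mod N"
      using * s by simp_all
    then show "p = q" unfolding pq using eq by metis
  qed
  have A_K: "A \<subseteq> K - {0}" by (auto simp: A_def power_K simp del: power_eq_0_iff)
  have card_A: "card A = s * h" unfolding A_def card_image[OF inj] by simp
  \<comment> \<open>Each coset contributes a multiple of a geometric series in \<open>g ^ N\<close>,
    which vanishes because \<open>g ^ N \<noteq> 1\<close> has \<open>h\<close>-th power
    \<open>1\<close>.\<close>
  have sum_A: "\<Sum>A = 0"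
  proof -
    have "\<not> N * h dvd N" using h s by (auto dest: dvd_imp_le)
    then have "g ^ N \<noteq> 1" using order[of N] N by (simp only: not_False_eq_True)
    then have "(\<Sum>j<h. (g ^ N) ^ j) = ((g ^ N) ^ h - 1) / (g ^ N - 1)" by (rule geometric_sum)
    also have "(g ^ N) ^ h = 1" using order[of "N * h"] by (simp only: N dvd_refl power_mult[symmetric])
    finally have 0: "(\<Sum>j<h. (g ^ N) ^ j) = 0" by simp
    have "\<Sum>A = (\<Sum>(j, i)\<in>{..<h} \<times> {..<s}. g ^ (N * j + i))"
      unfolding A_def by (subst sum.reindex[OF inj]) (simp add: case_prod_unfold)
    also have "\<dots> = (\<Sum>j<h. \<Sum>i<s. (g ^ N) ^ j * g ^ i)"
      by (simp add: sum.cartesian_product power_add power_mult)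
    also have "\<dots> = 0" using 0 by (simp flip: sum_product)
    finally show ?thesis .
  qed
  have dil: "dilations K (insert 0 A) = (\<lambda>j. g ^ (N * j)) ` {..<h}"
  proof (intro equalityI subsetI)
    fix u assume "u \<in> dilations K (insert 0 A)"
    then have u0: "u \<in> K - {0}" and u: "\<And>t. t \<in> A \<Longrightarrow> t * u \<in> A"
      by (auto simp: dilations_def dest: subsetD[OF A_K])
    from u0 obtain n where n: "u = g ^ n" using g by blast
    have *: "(i + n) mod N < s" if "i < s" for i
      using u[of "g ^ i"] that s by (simp add: n mem flip: power_add)
    \<comment> \<open>The shift by \<open>n\<close> keeps residues below \<open>s\<close>. Applied
      to \<open>0\<close> this gives \<open>n mod N < s\<close>; if \<open>n mod N\<close> were
      nonzero, \<open>s - n mod N\<close> would be shifted to \<open>s\<close>, out of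
      range.\<close>
    have "n mod N = 0"
    proof (rule ccontr)
      assume "n mod N \<noteq> 0"
      have lt: "n mod N < s" using *[of 0] s by simp
      have "s - n mod N < s" using \<open>n mod N \<noteq> 0\<close> s by simp
      from *[OF this] have "(s - n mod N + n mod N) mod N < s" by (simp only: mod_add_right_eq)
      then show False using lt s by simp
    qed
    let ?q = "n mod (N * h)"
    have "?q < N * h" using s h by simp
    then have "?q div N < h" by (simp add: less_mult_imp_div_less mult.commute)
    moreover have "?q mod N = 0" using \<open>n mod N = 0\<close> by (simp add: mod_mod_cancel)
    then have "N * (?q div N) = ?q" by auto
    then have "u = g ^ (N * (?q div N))" unfolding n power_eq by simp
    ultimately show "u \<in> (\<lambda>j. g ^ (N * j)) ` {..<h}" by blast
  next
    fix u assume "u \<in> (\<lambda>j. g ^ (N * j)) ` {..<h}"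
    then obtain j where j: "u = g ^ (N * j)" by blast
    have "t * u \<in> A" if "t \<in> A" for t
    proof -
      obtain n where n: "t = g ^ n" using \<open>t \<in> A\<close> by (auto simp: A_def)
      then have "n mod N < s" using \<open>t \<in> A\<close> mem by simp
      then have "(n + N * j) mod N < s" by simp
      then show ?thesis unfolding n j power_add[symmetric] mem .
    qed
    then show "u \<in> dilations K (insert 0 A)" using j power_K by (auto simp: dilations_def)
  qed
  have "inj_on (\<lambda>j. g ^ (N * j)) {..<h}"
  proof (rule inj_onI)
    fix i j assume "i \<in> {..<h}" "j \<in> {..<h}" "g ^ (N * i) = g ^ (N * j)"
    then show "i = j" using bound[of i 0] bound[of j 0] s unfolding power_eq by simp
  qed
  then have "card (dilations K (insert 0 A)) = h" unfolding dil by (simp add: card_image)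
  moreover have "0 \<notin> A" using A_K by auto
  ultimately show ?thesis using that[of "insert 0 A"] A_K card_A sum_A zero by auto
qed

end

section \<open>The subfield of order \<open>r\<close>, and the equivalence\<close>

lemma subfield_exists:
  assumes p: "Factorial_Ring.prime p" and "k > 0" and r: "r = p ^ k"
    and card: "CARD('a::{field,finite}) = r ^ 2"
  obtains K :: "'a::{field,finite} set" and g where "quadratic_extension K" "card K = r" "g \<noteq> 0"
    "K - {0} = range ((^) g)" "\<And>n. g ^ n = 1 \<longleftrightarrow> r - 1 dvd n"
proof -
  have r1: "r > 1" using p \<open>k > 0\<close> r prime_gt_1_nat one_less_power by blast
  have char: "CHAR('a) = p"
    by (rule CHAR_eq_prime[OF p, of "k * 2"]) (simp add: card r power_mult)
  obtain \<gamma> :: 'a where \<gamma>: "\<gamma> \<noteq> 0" "UNIV - {0} = range ((^) \<gamma>)"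
    "\<And>n. \<gamma> ^ n = 1 \<longleftrightarrow> CARD('a) - 1 dvd n"
    by (rule finite_field_generator) blast
  have card': "CARD('a) - 1 = (r + 1) * (r - 1)"
    using r1 by (simp add: card power2_eq_square algebra_simps)
  \<comment> \<open>\<open>\<gamma>\<close> has order \<open>(r + 1) * (r - 1)\<close>, so this
    power has order \<open>r - 1\<close>.\<close>
  define g where "g = \<gamma> ^ (r + 1)"
  \<comment> \<open>The fixed field of the Frobenius power \<open>x \<mapsto> x ^ r\<close>.\<close>
  define K where "K = {x :: 'a. x ^ r = x}"
  have g0: "g \<noteq> 0" using \<gamma>(1) by (simp add: g_def)
  have order: "g ^ n = 1 \<longleftrightarrow> r - 1 dvd n" for n
    unfolding g_def power_mult[symmetric] \<gamma>(3) card' by (rule dvd_times_left_cancel_iff) simp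
  have root: "x ^ r = x \<longleftrightarrow> x ^ (r - 1) = 1" if "x \<noteq> 0" for x :: 'a
    using that r1 power_minus_mult[of r x] by (metis mult_cancel_right2 zero_less_one less_trans)
  have range: "K - {0} = range ((^) g)"
  proof (intro equalityI subsetI)
    fix x assume x: "x \<in> K - {0}"
    then obtain i where i: "x = \<gamma> ^ i" using \<gamma>(2) by blast
    have "x ^ (r - 1) = 1" using x root[of x] by (simp add: K_def)
    then have "\<gamma> ^ (i * (r - 1)) = 1" by (simp add: i power_mult)
    then have "r + 1 dvd i" using r1 unfolding \<gamma>(3) card' by (subst (asm) dvd_times_right_cancel_iff) simp_all
    then obtain j where "i = (r + 1) * j" by blast
    then have "x = g ^ j" by (simp only: i g_def power_mult)
    then show "x \<in> range ((^) g)" by blast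
  next
    fix x assume "x \<in> range ((^) g)"
    then obtain i where "x = g ^ i" by blast
    then have "x \<noteq> 0" "x ^ (r - 1) = (g ^ (r - 1)) ^ i"
      using g0 by (simp_all flip: power_mult add: mult.commute)
    then show "x \<in> K - {0}" using root order[of "r - 1"] by (simp add: K_def)
  qed
  have "0 \<in> K" using r1 by (simp add: K_def)
  have card_K: "card K = r"
  proof -
    have "card (K - {0}) = r - 1"
      using range_power_eq[OF g0 order] r1 unfolding range by (simp add: card_image)
    then show ?thesis using \<open>0 \<in> K\<close> r1 by (simp add: card_Diff_singleton)
  qed
  have "quadratic_extension K"
  proof
    fix x y assume xy: "x \<in> K" "y \<in> K"
    have "((x - y) + y) ^ r = (x - y) ^ r + y ^ r"
      by (rule freshmans_dream'[of r k]) (simp_all add: char p r)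
    then show "x - y \<in> K" using xy by (simp add: K_def eq_diff_eq)
    show "x / y \<in> K" using xy by (simp add: K_def power_divide)
  qed (simp_all add: K_def card card_K[unfolded K_def])
  then show ?thesis using that card_K g0 range order by blast
qed

theorem theorem9:
  fixes p r m h :: nat
  assumes "Factorial_Ring.prime p" and "\<exists>k>0. r = p ^ k"
    and "CARD('a::{field,finite}) = r ^ 2"
    and "2 < m" and "m < r - 1" and "\<not> p dvd (m - 1)"
    and "h > 0"
  shows "(\<exists>(K :: 'a set) S L x.
            desarguesian_net r m K S \<and> L \<in> net_lines K S \<and> x \<notin> L \<and>
            card (net_clique S x L) = m - 1 + h)
         \<longleftrightarrow> h dvd gcd (r - 1) (m - 2)"
proof -
  obtain k where k: "k > 0" "r = p ^ k" using assms(2) by blast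
  have char: "CHAR('a) = p"
    by (rule CHAR_eq_prime[OF assms(1), of "k * 2"]) (simp add: assms(3) k power_mult)
  then have nz: "of_nat (m - 1) \<noteq> (0::'a)" using assms(6) by (simp only: of_nat_eq_0_iff_char_dvd) simp
  show ?thesis
  proof (intro iffI; (elim exE conjE)?)
    fix K :: "'a set" and S L x
    assume net: "desarguesian_net r m K S" "L \<in> net_lines K S" "x \<notin> L"
      and clique: "card (net_clique S x L) = m - 1 + h"
    interpret quadratic_extension K
      using net(1) unfolding desarguesian_net_def subfield_ring_of_type_algebra_iff
      by unfold_locales auto
    obtain h' where "card (net_clique S x L) = m - 1 + h'" "h' dvd gcd (r - 1) (m - 2)"
      using card_net_clique_dvd[OF net _ nz] assms(4) by auto
    then show "h dvd gcd (r - 1) (m - 2)" using clique by simp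
  next
    assume h: "h dvd gcd (r - 1) (m - 2)"
    obtain K :: "'a set" and g where "quadratic_extension K" and order_K: "card K = r"
      and g: "g \<noteq> 0" "K - {0} = range ((^) g)" "\<And>n. g ^ n = 1 \<longleftrightarrow> r - 1 dvd n"
      by (rule subfield_exists[OF assms(1) k assms(3)]) blast
    then interpret quadratic_extension K by simp
    obtain T where T: "T \<subseteq> K" "card T = m - 1" "\<Sum>T = 0"
      "(if 0 \<in> T then card (dilations K T) else 1) = h"
    proof (cases "h = 1")
      case True
      \<comment> \<open>In characteristic 2, \<open>p = 2\<close> does not divide
        \<open>m - 1\<close>, and \<open>r\<close> is a power of 2.\<close>
      have two: "odd (m - 1) \<and> even (card K)" if "(1 + 1 :: 'a) = 0"
      proof -
        have "of_nat 2 = (0::'a)" using that by simp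
        then have "p = 2"
          using assms(1) by (metis char of_nat_eq_0_iff_char_dvd primes_dvd_imp_eq two_is_prime_nat)
        then show ?thesis using assms(6) k by (simp add: order_K)
      qed
      have "2 \<le> m - 1" "m - 1 + 3 \<le> card K" using assms(4,5) order_K by linarith+
      then obtain T where "T \<subseteq> K" "card T = m - 1" "\<Sum>T = 0"
        "0 \<notin> T \<or> card (dilations K T) = 1"
        using two by (rule zero_sum_no_dilations)
      then show ?thesis using that[of T] True by auto
    next
      case False
      \<comment> \<open>\<open>s\<close> cosets of the group of order \<open>h\<close>, together
        with \<open>0\<close>, make \<open>m - 1\<close> points; \<open>m < r - 1\<close> gives
        \<open>s < N\<close>.\<close>
      obtain N s where N: "r - 1 = N * h" and s: "m - 2 = s * h"
        using h unfolding gcd_greatest_iff by (metis dvdE mult.commute)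
      have "0 < s" using s assms(4) by (intro gr0I) auto
      have "s * h < N * h" using N s assms(4,5) by linarith
      then have "s < N" by simp
      have "1 < h" using False assms(7) by simp
      obtain T where "T \<subseteq> K" "card T = s * h + 1" "\<Sum>T = 0" "0 \<in> T" "card (dilations K T) = h"
        by (rule zero_sum_dilations[OF g[folded order_K] N[folded order_K] \<open>1 < h\<close> \<open>0 < s\<close> \<open>s < N\<close>])
      then show ?thesis using that[of T] s assms(4) by simp
    qed
    obtain S L x where "desarguesian_net (card K) (card T + 1) K S" "L \<in> net_lines K S" "x \<notin> L"
      "card (net_clique S x L) = card T + (if 0 \<in> T then card (dilations K T) else 1)"
      using net_clique_exists[OF T(1,3)] nz T(2) by metis
    then show "\<exists>(K :: 'a set) S L x. desarguesian_net r m K S \<and> L \<in> net_lines K S \<and> x \<notin> L \<and>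
        card (net_clique S x L) = m - 1 + h"
      using T assms(4) by (intro exI[of _ K] exI[of _ S] exI[of _ L] exI[of _ x]) (simp add: order_K)
  qed
qed

end
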